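(* Let $N\ge 5$, let $\Omega\subset\mathbb{R}^N$ be a smooth bounded domain. Let $a\in L^1_{loc}(\Omega)$ and $b\in L^2(\Omega)$ be nonnegative, $b\not\equiv 0$, and let $\gamma>0$ be such that $$\int_\Omega\left(|\Delta u|^2-a(x)^2u^2\right)dx\ge\gamma\int_\Omega u^2\,dx\qquad\forall u\in W^{2,2}(\Omega)\cap W^{1,2}_0(\Omega).$$ Let $0<\mu<\sqrt{\gamma}$. Let $f:[0,\infty)\to[0,\infty)$ be a convex $C^1$ function with $f(0)=0=f'(0)$, $\lim_{t\to\infty}f(t)/t=\infty$, $\int_1^\infty g(s)\,ds<\infty$ and $sg(s)<1$ for $s>1$, where $g(s)=\sup_{t>0}\frac{f(t)}{f(ts)}$ for $s\ge1$. Define $$\tilde\lambda^*=\sup\{\lambda>0:(P_\lambda)\text{ has a very weak (distributional) solution}\}.$$ Then $\tilde\lambda^*<\infty$.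
   Context: $(P_\lambda)$ is the problem $\Delta^2u-\mu a(x)u=f(u)+\lambda b(x)$ in $\Omega$, $u>0$ in $\Omega$, $u=0=\Delta u$ on $\partial\Omega$, where $\lambda>0$. A very weak solution (distributional solution) of $(P_\lambda)$ is a function $u\in L^1(\Omega)$ with $u>0$ a.e., $\mu a u+f(u)\in L^1_{loc}(\Omega)$ and $\int_\Omega u(\Delta^2\phi-\mu a\phi)\,dx=\int_\Omega(f(u)+\lambda b)\phi\,dx$ for all $\phi\in C_0^\infty(\Omega)$. In the definition of $g$, the quotient $0/0$ is read as $0$. *)

theory Defs
  imports "HOL-Analysis.Analysis"
begin

fun iter_partial :: "'a list \<Rightarrow> ('a::euclidean_space \<Rightarrow> real) \<Rightarrow> 'a \<Rightarrow> real" where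
  "iter_partial [] f = f"
| "iter_partial (e # es) f = (\<lambda>x. frechet_derivative (iter_partial es f) (at x) e)"

text \<open>Differentiability of all iterated partial derivatives makes each of them continuous, so this
  is the class of \<open>C\<^sup>\<infinity>\<close> functions on the whole space.\<close>

definition smooth :: "('a::euclidean_space \<Rightarrow> real) \<Rightarrow> bool" where
  "smooth f \<longleftrightarrow> (\<forall>es. set es \<subseteq> Basis \<longrightarrow> (\<forall>x. iter_partial es f differentiable (at x)))"

definition test_functions :: "'a::euclidean_space set \<Rightarrow> ('a \<Rightarrow> real) set" where
  "test_functions \<Omega> =
     {\<phi>. smooth \<phi> \<and> compact (closure {x. \<phi> x \<noteq> 0}) \<and> closure {x. \<phi> x \<noteq> 0} \<subseteq> \<Omega>}"

definition laplacian :: "('a::euclidean_space \<Rightarrow> real) \<Rightarrow> 'a \<Rightarrow> real" where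
  "laplacian \<phi> x = (\<Sum>e\<in>Basis. iter_partial [e, e] \<phi> x)"

text \<open>Near each boundary point, \<open>\<Omega>\<close> is the region strictly above the graph of a smooth function,
  where ``up'' is some unit vector \<open>e\<close>.  The graph function \<open>h\<close> is evaluated only on the
  hyperplane orthogonal to \<open>e\<close>, at the projection of \<open>x\<close>.\<close>

definition smooth_boundary :: "'a::euclidean_space set \<Rightarrow> bool" where
  "smooth_boundary \<Omega> \<longleftrightarrow>
     (\<forall>p\<in>frontier \<Omega>. \<exists>r>0. \<exists>e h. norm e = 1 \<and> smooth h \<and>
        \<Omega> \<inter> ball p r = {x \<in> ball p r. h (x - (x \<bullet> e) *\<^sub>R e) < x \<bullet> e})"

definition smooth_bounded_domain :: "'a::euclidean_space set \<Rightarrow> bool" where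
  "smooth_bounded_domain \<Omega> \<longleftrightarrow>
     open \<Omega> \<and> connected \<Omega> \<and> \<Omega> \<noteq> {} \<and> bounded \<Omega> \<and> smooth_boundary \<Omega>"

text \<open>Elements of these spaces are functions, not classes of functions; only the values on
  \<open>\<Omega>\<close>, up to null sets, matter.\<close>

definition L1 :: "'a::euclidean_space set \<Rightarrow> ('a \<Rightarrow> real) set" where
  "L1 \<Omega> = {u. set_integrable lebesgue \<Omega> u}"

definition L1_loc :: "'a::euclidean_space set \<Rightarrow> ('a \<Rightarrow> real) set" where
  "L1_loc \<Omega> = {u. \<forall>K. compact K \<and> K \<subseteq> \<Omega> \<longrightarrow> set_integrable lebesgue K u}"

definition L2 :: "'a::euclidean_space set \<Rightarrow> ('a \<Rightarrow> real) set" where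
  "L2 \<Omega> = {u. set_borel_measurable lebesgue \<Omega> u \<and> set_integrable lebesgue \<Omega> (\<lambda>x. (u x)\<^sup>2)}"

definition has_weak_partial ::
    "'a::euclidean_space set \<Rightarrow> 'a list \<Rightarrow> ('a \<Rightarrow> real) \<Rightarrow> ('a \<Rightarrow> real) \<Rightarrow> bool" where
  "has_weak_partial \<Omega> es u v \<longleftrightarrow>
     u \<in> L1_loc \<Omega> \<and> v \<in> L1_loc \<Omega> \<and>
     (\<forall>\<phi>\<in>test_functions \<Omega>.
        (LINT x:\<Omega>|lebesgue. u x * iter_partial es \<phi> x)
          = (- 1) ^ length es * (LINT x:\<Omega>|lebesgue. v x * \<phi> x))"

text \<open>A weak derivative is unique only up to null sets; the choice made here is irrelevant inside
  integrals over \<open>\<Omega>\<close>.\<close>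

definition weak_partial ::
    "'a::euclidean_space set \<Rightarrow> 'a list \<Rightarrow> ('a \<Rightarrow> real) \<Rightarrow> 'a \<Rightarrow> real" where
  "weak_partial \<Omega> es u = (SOME v. has_weak_partial \<Omega> es u v)"

definition weak_laplacian ::
    "'a::euclidean_space set \<Rightarrow> ('a \<Rightarrow> real) \<Rightarrow> 'a \<Rightarrow> real" where
  "weak_laplacian \<Omega> u x = (\<Sum>e\<in>Basis. weak_partial \<Omega> [e, e] u x)"

text \<open>\<open>W2 k \<Omega>\<close> is the Sobolev space of order \<open>k\<close> and exponent 2, usually written with
  superscript \<open>k,2\<close>; it is not the space of order 2.\<close>

definition W2 :: "nat \<Rightarrow> 'a::euclidean_space set \<Rightarrow> ('a \<Rightarrow> real) set" where
  "W2 k \<Omega> = {u \<in> L2 \<Omega>. \<forall>es. set es \<subseteq> Basis \<and> length es \<le> k \<longrightarrow>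
                 (\<exists>v\<in>L2 \<Omega>. has_weak_partial \<Omega> es u v)}"

definition W12_0 :: "'a::euclidean_space set \<Rightarrow> ('a \<Rightarrow> real) set" where
  "W12_0 \<Omega> = {u \<in> W2 1 \<Omega>. \<exists>\<phi>::nat \<Rightarrow> 'a \<Rightarrow> real.
     (\<forall>n. \<phi> n \<in> test_functions \<Omega>) \<and>
     (\<lambda>n. LINT x:\<Omega>|lebesgue. (\<phi> n x - u x)\<^sup>2) \<longlonglongrightarrow> 0 \<and>
     (\<forall>e\<in>Basis. (\<lambda>n. LINT x:\<Omega>|lebesgue. (iter_partial [e] (\<phi> n) x - weak_partial \<Omega> [e] u x)\<^sup>2)
        \<longlonglongrightarrow> 0)}"

text \<open>Integrability of \<open>a\<^sup>2 u\<^sup>2\<close> is not assumed separately.  For \<open>u\<close> in the space below, the first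
  integral is minus infinity whenever that function is not integrable; the Bochner integral then
  has the value 0, and the inequality still fails, as \<open>u\<close> is not zero almost everywhere.\<close>

definition stability_inequality ::
    "'a::euclidean_space set \<Rightarrow> ('a \<Rightarrow> real) \<Rightarrow> real \<Rightarrow> bool" where
  "stability_inequality \<Omega> a \<gamma> \<longleftrightarrow>
     (\<forall>u\<in>W2 2 \<Omega> \<inter> W12_0 \<Omega>.
        (LINT x:\<Omega>|lebesgue. \<bar>weak_laplacian \<Omega> u x\<bar>\<^sup>2 - (a x)\<^sup>2 * (u x)\<^sup>2)
          \<ge> \<gamma> * (LINT x:\<Omega>|lebesgue. (u x)\<^sup>2))"

text \<open>Division by zero yields 0, which covers the convention 0/0 = 0.  For \<open>s \<ge> 1\<close> and a
  nonnegative convex \<open>f\<close> with \<open>f 0 = 0\<close>, hence nondecreasing, no other division by zero occurs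
  and the quotients are bounded by 1, so the real supremum is the true one.\<close>

definition ratio_sup :: "(real \<Rightarrow> real) \<Rightarrow> real \<Rightarrow> real" where
  "ratio_sup f s = (SUP t\<in>{0<..}. f t / f (t * s))"

definition very_weak_solution ::
    "'a::euclidean_space set \<Rightarrow> real \<Rightarrow> ('a \<Rightarrow> real) \<Rightarrow> ('a \<Rightarrow> real) \<Rightarrow> (real \<Rightarrow> real) \<Rightarrow> real
      \<Rightarrow> ('a \<Rightarrow> real) \<Rightarrow> bool" where
  "very_weak_solution \<Omega> \<mu> a b f lam u \<longleftrightarrow>
     u \<in> L1 \<Omega> \<and>
     (AE x\<in>\<Omega> in lebesgue. u x > 0) \<and>
     (\<lambda>x. \<mu> * a x * u x + f (u x)) \<in> L1_loc \<Omega> \<and>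
     (\<forall>\<phi>\<in>test_functions \<Omega>.
        (LINT x:\<Omega>|lebesgue. u x * (laplacian (laplacian \<phi>) x - \<mu> * a x * \<phi> x))
          = (LINT x:\<Omega>|lebesgue. (f (u x) + lam * b x) * \<phi> x))"

definition extremal_parameter ::
    "'a::euclidean_space set \<Rightarrow> real \<Rightarrow> ('a \<Rightarrow> real) \<Rightarrow> ('a \<Rightarrow> real) \<Rightarrow> (real \<Rightarrow> real) \<Rightarrow> ereal" where
  "extremal_parameter \<Omega> \<mu> a b f =
     Sup (ereal ` {lam. lam > 0 \<and> (\<exists>u. very_weak_solution \<Omega> \<mu> a b f lam u)})"

end

theory Submission
  imports Defs
begin

text \<open>The condition on \<open>ratio_sup f\<close> at the single point 2 gives \<open>f (2 t) \<ge> k f t\<close> with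
  \<open>k > 2\<close>, hence \<open>f t \<ge> A t\<^sup>p - K\<close> for some \<open>p > 1\<close>.  Test the equation with
  \<open>\<phi> x = exp (- 1 / (r\<^sup>2 - \<bar>x - c\<bar>\<^sup>2))\<close>, on a ball where \<open>b\<close> does not vanish.  Every
  derivative of \<open>\<phi>\<close> is \<open>O(\<phi>\<^sup>q)\<close> for each \<open>q < 1\<close>; with \<open>q = 1 / p\<close>, Young's inequality absorbs
  \<open>u \<Delta>\<^sup>2\<phi>\<close> into \<open>f u \<phi>\<close> up to a constant that depends neither on \<open>u\<close> nor on \<open>\<lambda>\<close>.  As
  \<open>\<mu> a u \<phi> \<ge> 0\<close> has the favourable sign, this bounds \<open>\<lambda> \<integral> b \<phi>\<close>.\<close>

section \<open>The one-variable profile and its derivatives\<close>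

text \<open>Index 0 is the classical smooth function \<open>exp (- 1 / s)\<close>, extended by 0.
  The factors \<open>1 / s ^ k\<close> are built in because differentiation creates them, so the
  span of the family is closed under derivatives.\<close>

definition bump_profile :: "nat \<Rightarrow> real \<Rightarrow> real" where
  "bump_profile k s = (if s \<le> 0 then 0 else exp (- 1 / s) / s ^ k)"

text \<open>A single term of the exponential series, whose terms are all nonnegative here.\<close>

lemma power_le_fact_exp:
  fixes y :: real assumes "y \<ge> 0"
  shows "y ^ k \<le> fact k * exp y"
proof -
  have s: "summable (\<lambda>n. inverse (fact n) * y ^ n)" by (rule summable_exp)
  have "(\<Sum>n\<in>{k}. inverse (fact n) * y ^ n) \<le> (\<Sum>n. inverse (fact n) * y ^ n)"
    by (rule sum_le_suminf[OF s]) (use assms in auto)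
  also have "\<dots> = exp y" by (simp add: exp_def divide_inverse)
  finally show ?thesis by (simp add: field_simps)
qed

lemma bump_profile_nonneg: "bump_profile k s \<ge> 0"
  by (simp add: bump_profile_def)

lemma bump_profile_0_le_1: "bump_profile 0 s \<le> 1"
  by (simp add: bump_profile_def)

text \<open>With \<open>y = 1 / s\<close>, the factor \<open>exp (- y)\<close> splits into
  \<open>exp (- (1 - q) * y)\<close>, which beats \<open>y ^ k\<close>, and
  \<open>exp (- q * y)\<close>, which is the power \<open>q\<close> of the profile of index
  0.\<close>

lemma bump_profile_le_powr:
  assumes q: "q < 1"
  shows "bump_profile k s \<le> fact k / (1 - q) ^ k * bump_profile 0 s powr q"
proof (cases "s \<le> 0")
  case False
  define y where "y = 1 / s"
  have y: "y > 0" using False by (simp add: y_def)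
  have "((1 - q) * y) ^ k \<le> fact k * exp ((1 - q) * y)"
    by (rule power_le_fact_exp) (use y q in auto)
  then have "y ^ k * (1 - q) ^ k \<le> fact k * exp ((1 - q) * y)"
    by (simp add: power_mult_distrib mult.commute)
  then have "y ^ k \<le> fact k / (1 - q) ^ k * exp ((1 - q) * y)"
    using q by (simp add: field_simps)
  then have "y ^ k * exp (- y) \<le> fact k / (1 - q) ^ k * exp ((1 - q) * y) * exp (- y)"
    by (rule mult_right_mono) simp
  also have "\<dots> = fact k / (1 - q) ^ k * (exp (- y) powr q)"
    by (simp add: powr_def mult_exp_exp algebra_simps flip: exp_add)
  finally show ?thesis
    using False by (simp add: bump_profile_def y_def power_one_over field_simps)
qed (simp add: bump_profile_def)

text \<open>The previous estimate with \<open>q = 0\<close> bounds the profile of index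
  \<open>k + 1\<close> by a constant; multiplying by \<open>s\<close> lowers the index. This linear
  decay controls the difference quotients at 0.\<close>

lemma bump_profile_le: "bump_profile k s \<le> fact (Suc k) * \<bar>s\<bar>"
proof (cases "s \<le> 0")
  case False
  have "bump_profile (Suc k) s \<le> fact (Suc k) / (1 - 0) ^ Suc k * bump_profile 0 s powr 0"
    by (rule bump_profile_le_powr) simp
  also have "\<dots> \<le> fact (Suc k)" by (simp add: powr_def)
  finally show ?thesis using False by (simp add: bump_profile_def field_simps)
next
  case True
  have "0 \<le> fact (Suc k) * \<bar>s\<bar>" by (intro mult_nonneg_nonneg) auto
  then show ?thesis using True by (simp only: bump_profile_def if_True)
qed

text \<open>For \<open>s > 0\<close> this is the usual differentiation rule. At 0 the difference
  quotient is itself a profile, of the next index, and tends to 0.\<close>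

lemma has_real_derivative_bump_profile:
  "(bump_profile k has_real_derivative
     bump_profile (k + 2) s - k * bump_profile (k + 1) s) (at s)"
proof -
  consider "s < 0" | "s = 0" | "s > 0" by linarith
  then show ?thesis
  proof cases
    case 1
    have "((\<lambda>s. 0) has_real_derivative 0) (at s)" by simp
    then have "(bump_profile k has_real_derivative 0) (at s)"
      by (rule DERIV_cong_ev[THEN iffD1, rotated -1])
        (use 1 in \<open>auto simp: bump_profile_def eventually_nhds intro!: exI[of _ "{..<0}"]\<close>)
    then show ?thesis using 1 by (simp add: bump_profile_def)
  next
    case 2
    have "((\<lambda>h. bump_profile k h / h) \<longlongrightarrow> 0) (at 0)"
    proof (rule Lim_null_comparison)
      show "\<forall>\<^sub>F h in at 0. norm (bump_profile k h / h) \<le> fact (k + 2) * \<bar>h\<bar>"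
      proof (rule always_eventually, rule allI)
        fix h
        \<comment> \<open>Dividing by \<open>h > 0\<close> raises the index by one; for
          \<open>h \<le> 0\<close> both sides are 0.\<close>
        have "norm (bump_profile k h / h) = bump_profile (Suc k) h"
          by (simp add: bump_profile_def abs_mult)
        then show "norm (bump_profile k h / h) \<le> fact (k + 2) * \<bar>h\<bar>"
          using bump_profile_le[of "Suc k" h] by simp
      qed
      show "((\<lambda>h::real. fact (k + 2) * \<bar>h\<bar>) \<longlongrightarrow> 0) (at 0)"
        by (auto intro!: tendsto_eq_intros)
    qed
    then show ?thesis using 2 by (simp add: DERIV_def bump_profile_def)
  next
    case 3
    have "((\<lambda>s. exp (- 1 / s) / s ^ k) has_real_derivative
        bump_profile (k + 2) s - k * bump_profile (k + 1) s) (at s)"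
    proof (cases k)
      case 0
      then show ?thesis using 3
        by (auto intro!: derivative_eq_intros simp: bump_profile_def power2_eq_square)
    next
      case (Suc j)
      then show ?thesis using 3
        by (auto intro!: derivative_eq_intros simp: bump_profile_def)
          (cases j; simp add: divide_simps power2_eq_square; simp add: algebra_simps)
    qed
    then show ?thesis
      by (rule DERIV_cong_ev[THEN iffD1, rotated -1])
        (use 3 in \<open>auto simp: bump_profile_def eventually_nhds intro!: exI[of _ "{0<..}"]\<close>)
  qed
qed

section \<open>Functions generated by the bump: smoothness and bounds\<close>

text \<open>Rational functions of the coordinates times the bump: a class closed under
  differentiation.\<close>

inductive bump_span :: "'a::euclidean_space \<Rightarrow> real \<Rightarrow> ('a \<Rightarrow> real) \<Rightarrow> bool" for c r where
  profile: "bump_span c r (\<lambda>x. bump_profile k (r\<^sup>2 - (x - c) \<bullet> (x - c)))"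
| coord: "bump_span c r h \<Longrightarrow> bump_span c r (\<lambda>x. h x * ((x - c) \<bullet> e))"
| add: "bump_span c r h \<Longrightarrow> bump_span c r h' \<Longrightarrow> bump_span c r (\<lambda>x. h x + h' x)"
| scale: "bump_span c r h \<Longrightarrow> bump_span c r (\<lambda>x. \<alpha> * h x)"

lemma bump_span_sum:
  assumes "finite I" "\<And>i. i \<in> I \<Longrightarrow> bump_span c r (h i)"
  shows "bump_span c r (\<lambda>x. \<Sum>i\<in>I. h i x)"
  using assms
proof (induction rule: finite_induct)
  case empty
  \<comment> \<open>The zero function belongs to the class as 0 times a generator.\<close>
  show ?case using bump_span.scale[OF bump_span.profile, of c r 0 0] by simp
next
  case (insert i I)
  then show ?case by (auto intro: bump_span.add)
qed

text \<open>By induction. At a generator the chain rule gives profiles of index \<open>k + 1\<close>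
  and \<open>k + 2\<close>, multiplied by the inner derivative
  \<open>- 2 * ((x - c) \<bullet> e)\<close>, which is a coordinate factor again.\<close>

lemma bump_span_has_derivative:
  assumes "bump_span c r h"
  obtains h' where "\<And>x. (h has_derivative h' x) (at x)" "\<And>e. bump_span c r (\<lambda>x. h' x e)"
proof -
  have "\<exists>h'. (\<forall>x. (h has_derivative h' x) (at x)) \<and> (\<forall>e. bump_span c r (\<lambda>x. h' x e))"
    using assms
  proof induction
    case (profile k)
    let ?s = "\<lambda>x. r\<^sup>2 - (x - c) \<bullet> (x - c)"
    let ?h' = "\<lambda>x e. (bump_profile (k + 2) (?s x) - k * bump_profile (k + 1) (?s x)) *
      (- 2 * ((x - c) \<bullet> e))"
    have "((\<lambda>x. bump_profile k (?s x)) has_derivative ?h' x) (at x)" for x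
    proof -
      have "(?s has_derivative (\<lambda>e. - 2 * ((x - c) \<bullet> e))) (at x)"
        by (auto intro!: derivative_eq_intros simp: inner_commute)
      from has_derivative_compose[OF this
          has_real_derivative_bump_profile[unfolded has_field_derivative_def]]
      show ?thesis by simp
    qed
    moreover have "bump_span c r (\<lambda>x. ?h' x e)" for e
    proof -
      have "bump_span c r (\<lambda>x. (- 2) * ((bump_profile (k + 2) (?s x)
          + (- real k) * bump_profile (k + 1) (?s x)) * ((x - c) \<bullet> e)))"
        by (intro bump_span.intros)
      then show ?thesis by (simp add: algebra_simps)
    qed
    ultimately show ?case by (intro exI[of _ ?h']) auto
  next
    case (coord h e)
    then obtain h' where h': "\<And>x. (h has_derivative h' x) (at x)" "\<And>e. bump_span c r (\<lambda>x. h' x e)"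
      by blast
    let ?h' = "\<lambda>x d. h x * (d \<bullet> e) + h' x d * ((x - c) \<bullet> e)"
    have "((\<lambda>x. h x * ((x - c) \<bullet> e)) has_derivative ?h' x) (at x)" for x
      by (auto intro!: derivative_eq_intros h')
    moreover have "bump_span c r (\<lambda>x. ?h' x d)" for d
    proof -
      have "bump_span c r (\<lambda>x. (d \<bullet> e) * h x + h' x d * ((x - c) \<bullet> e))"
        by (intro bump_span.intros coord.hyps h')
      then show ?thesis by (simp add: mult.commute)
    qed
    ultimately show ?case by (intro exI[of _ ?h'] conjI allI)
  next
    case (add h1 h2)
    then obtain h1' h2'
      where h': "\<And>x. (h1 has_derivative h1' x) (at x)" "\<And>e. bump_span c r (\<lambda>x. h1' x e)"
        "\<And>x. (h2 has_derivative h2' x) (at x)" "\<And>e. bump_span c r (\<lambda>x. h2' x e)"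
      by blast
    then show ?case
      by (intro exI[of _ "\<lambda>x e. h1' x e + h2' x e"] conjI allI bump_span.add has_derivative_add)
  next
    case (scale h \<alpha>)
    then obtain h' where h': "\<And>x. (h has_derivative h' x) (at x)" "\<And>e. bump_span c r (\<lambda>x. h' x e)"
      by blast
    then show ?case
      by (intro exI[of _ "\<lambda>x e. \<alpha> * h' x e"] conjI allI bump_span.scale has_derivative_mult_right)
  qed
  then show ?thesis using that by blast
qed

lemma bump_span_iter_partial:
  assumes "bump_span c r h"
  shows "bump_span c r (iter_partial es h)"
proof (induction es)
  case (Cons e es)
  obtain h' where h': "\<And>x. (iter_partial es h has_derivative h' x) (at x)"
    "\<And>e. bump_span c r (\<lambda>x. h' x e)"
    using bump_span_has_derivative[OF Cons] by blast
  \<comment> \<open>\<open>frechet_derivative\<close> is defined by choice; uniqueness of the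
    derivative identifies it with \<open>h'\<close>.\<close>
  have "frechet_derivative (iter_partial es h) (at x) = h' x" for x
    using frechet_derivative_at[OF h'(1)] by metis
  then show ?case using h'(2) by simp
qed (simp add: assms)

lemma bump_span_laplacian:
  assumes "bump_span c r h"
  shows "bump_span c r (laplacian h)"
proof -
  have "bump_span c r (\<lambda>x. \<Sum>e\<in>Basis. iter_partial [e, e] h x)"
    by (intro bump_span_sum bump_span_iter_partial assms) simp
  then show ?thesis by (simp only: laplacian_def[abs_def])
qed

lemma bump_span_differentiable:
  "bump_span c r h \<Longrightarrow> h differentiable (at x)"
  by (meson bump_span_has_derivative differentiable_def)

lemma bump_span_smooth: "bump_span c r h \<Longrightarrow> smooth h"
  by (auto simp: smooth_def intro: bump_span_differentiable bump_span_iter_partial)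

lemma bump_span_continuous: "bump_span c r h \<Longrightarrow> continuous_on S h"
  by (meson bump_span_differentiable continuous_at_imp_continuous_on
      differentiable_imp_continuous_within)

definition bump :: "'a::euclidean_space \<Rightarrow> real \<Rightarrow> 'a \<Rightarrow> real" where
  "bump c r x = bump_profile 0 (r\<^sup>2 - (x - c) \<bullet> (x - c))"

lemma bump_span_bump: "bump_span c r (bump c r)"
  using bump_span.profile[of c r 0] by (simp add: bump_def[abs_def])

lemma bump_nonneg: "bump c r x \<ge> 0"
  and bump_le_1: "bump c r x \<le> 1"
  by (simp_all add: bump_def bump_profile_nonneg bump_profile_0_le_1)

lemma bump_eq_0_iff:
  assumes "r > 0"
  shows "bump c r x = 0 \<longleftrightarrow> x \<notin> ball c r"
proof -
  have "r\<^sup>2 - (x - c) \<bullet> (x - c) \<le> 0 \<longleftrightarrow> r \<le> norm (x - c)"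
    using assms by (simp add: dot_square_norm abs_le_square_iff[symmetric])
  then show ?thesis
    by (simp add: bump_def bump_profile_def dist_norm norm_minus_commute not_less)
qed

lemma bump_test_function:
  assumes "r > 0" "cball c r \<subseteq> \<Omega>"
  shows "bump c r \<in> test_functions \<Omega>"
proof -
  have "{x. bump c r x \<noteq> 0} = ball c r"
    by (simp add: bump_eq_0_iff[OF assms(1)] ball_def)
  then show ?thesis
    using assms by (simp add: test_functions_def bump_span_smooth[OF bump_span_bump])
qed

text \<open>Generators obey the profile estimate, and sums and multiples preserve such a bound. A
  coordinate factor is unbounded on the whole space, but at most
  \<open>\<bar>r\<bar> * norm e\<close> in absolute value wherever the bump is nonzero.\<close>

lemma bump_span_bound:
  assumes "bump_span c r h" "q < 1"
  obtains C where "C \<ge> 0" "\<And>x. \<bar>h x\<bar> \<le> C * bump c r x powr q"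
proof -
  have "\<exists>C\<ge>0. \<forall>x. \<bar>h x\<bar> \<le> C * bump c r x powr q"
    using assms(1)
  proof induction
    case (profile k)
    show ?case
      by (rule exI[of _ "fact k / (1 - q) ^ k"])
        (use assms(2) bump_profile_le_powr[OF assms(2)] bump_profile_nonneg in \<open>auto simp: bump_def\<close>)
  next
    case (coord h e)
    then obtain C where C: "C \<ge> 0" "\<And>x. \<bar>h x\<bar> \<le> C * bump c r x powr q" by blast
    have "\<bar>h x * ((x - c) \<bullet> e)\<bar> \<le> (C * (\<bar>r\<bar> * norm e)) * bump c r x powr q" for x
    proof (cases "norm (x - c) \<le> \<bar>r\<bar>")
      case True
      have "\<bar>(x - c) \<bullet> e\<bar> \<le> norm (x - c) * norm e" by (rule Cauchy_Schwarz_ineq2)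
      also have "\<dots> \<le> \<bar>r\<bar> * norm e" using True by (intro mult_right_mono) auto
      finally have "\<bar>h x\<bar> * \<bar>(x - c) \<bullet> e\<bar> \<le> (C * bump c r x powr q) * (\<bar>r\<bar> * norm e)"
        by (intro mult_mono C) (auto simp: C(1))
      then show ?thesis by (simp add: abs_mult mult_ac)
    next
      case False
      then have "r\<^sup>2 \<le> (x - c) \<bullet> (x - c)"
        by (simp add: dot_square_norm abs_le_square_iff[symmetric])
      then have "bump c r x = 0" by (simp add: bump_def bump_profile_def)
      \<comment> \<open>As \<open>0 powr q = 0\<close>, the induction hypothesis forces
        \<open>h x = 0\<close>.\<close>
      with C(2)[of x] show ?thesis by simp
    qed
    with C(1) show ?case by (intro exI[of _ "C * (\<bar>r\<bar> * norm e)"]) auto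
  next
    case (add h1 h2)
    then obtain C1 C2 where "C1 \<ge> 0" "\<And>x. \<bar>h1 x\<bar> \<le> C1 * bump c r x powr q"
      "C2 \<ge> 0" "\<And>x. \<bar>h2 x\<bar> \<le> C2 * bump c r x powr q" by blast
    then show ?case
      by (intro exI[of _ "C1 + C2"]) (auto simp: distrib_right intro: abs_triangle_ineq[THEN order_trans] add_mono)
  next
    case (scale h \<alpha>)
    then obtain C where "C \<ge> 0" "\<And>x. \<bar>h x\<bar> \<le> C * bump c r x powr q" by blast
    then show ?case
      by (intro exI[of _ "\<bar>\<alpha>\<bar> * C"]) (auto simp: abs_mult mult.assoc intro!: mult_left_mono)
  qed
  then show ?thesis using that by blast
qed

section \<open>Power growth of the nonlinearity\<close>

text \<open>Iterating the doubling inequality along the points \<open>t0 * 2 ^ n\<close> gives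
  growth of order \<open>p = log 2 k\<close>, which exceeds 1 because \<open>k > 2\<close>.
  Monotonicity, a consequence of convexity and \<open>f 0 = 0\<close>, covers the points in
  between.\<close>

lemma superlinear_growth:
  fixes f :: "real \<Rightarrow> real"
  assumes nonneg: "\<And>t. t \<ge> 0 \<Longrightarrow> f t \<ge> 0"
    and conv: "convex_on {0..} f" and f0: "f 0 = 0"
    and lim: "filterlim (\<lambda>t. f t / t) at_top at_top"
    and g2: "2 * ratio_sup f 2 < 1"
  obtains p A K where "p > 1" "A > 0" "\<And>t. t \<ge> 0 \<Longrightarrow> f t \<ge> A * t powr p - K"
proof -
  have scale: "f (\<theta> * t) \<le> \<theta> * f t" if "0 \<le> \<theta>" "\<theta> \<le> 1" "t \<ge> 0" for \<theta> t
    using convex_onD[OF conv, of \<theta> 0 t] that f0 by simp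
  have mono: "f s \<le> f t" if "0 \<le> s" "s \<le> t" for s t
  proof (cases "t = 0")
    case False
    then have "f s \<le> s / t * f t" using scale[of "s / t" t] that by simp
    also have "\<dots> \<le> 1 * f t"
      using that False by (intro mult_right_mono nonneg) auto
    finally show ?thesis by simp
  qed (use that in simp)
  \<comment> \<open>A real supremum is an upper bound only for a bounded set. Monotonicity bounds
    the quotients by 1; those with denominator 0 are 0 by default.\<close>
  have bdd: "bdd_above ((\<lambda>t. f t / f (t * 2)) ` {0<..})"
    by (rule bdd_aboveI[of _ 1])
      (use mono nonneg in \<open>auto simp: divide_le_eq_1 not_less order.strict_iff_order\<close>)
  have ratio: "f t / f (t * 2) \<le> ratio_sup f 2" if "t > 0" for t
    unfolding ratio_sup_def by (rule cSUP_upper[OF _ bdd]) (use that in simp)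
  have "\<forall>\<^sub>F t in at_top. f t / t \<ge> 1" using lim by (auto simp: filterlim_at_top)
  then have "\<forall>\<^sub>F t in at_top. f t / t \<ge> 1 \<and> t > 0"
    by (intro eventually_conj eventually_gt_at_top)
  then obtain t0 where t0: "t0 > 0" "f t0 / t0 \<ge> 1"
    by (auto simp: eventually_at_top_linorder)
  then have ft0: "f t0 > 0" by (simp add: field_simps)
  then have pos: "f t > 0" if "t \<ge> t0" for t using mono[of t0 t] that t0 by simp
  define k where "k = 1 / ratio_sup f 2"
  have g_pos: "ratio_sup f 2 > 0"
    using ratio[OF t0(1)] ft0 pos[of "t0 * 2"] t0(1) by (smt (verit) divide_pos_pos)
  have k: "k > 2" using g_pos g2 by (simp add: k_def field_simps)
  have double: "f (t * 2) \<ge> k * f t" if "t \<ge> t0" for t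
    using ratio[of t] pos[of "t * 2"] that t0(1) g_pos by (simp add: k_def field_simps)
  have iter: "f (t0 * 2 ^ n) \<ge> f t0 * k ^ n" for n
  proof (induction n)
    case (Suc n)
    have "f t0 * k ^ Suc n \<le> k * f (t0 * 2 ^ n)" using Suc k by (simp add: mult.commute mult.left_commute)
    also have "\<dots> \<le> f (t0 * 2 ^ Suc n)"
      using double[of "t0 * 2 ^ n"] t0(1) by (simp add: mult_ac)
    finally show ?case .
  qed simp
  define p where "p = log 2 k"
  have p: "p > 1" using k by (simp add: p_def less_log_iff)
  have k_p: "k = 2 powr p" using k by (simp add: p_def)
  \<comment> \<open>The factor 2 in \<open>2 * t0\<close> pays for rounding the number of doublings
    down: \<open>t\<close> is less than twice \<open>t0 * 2 ^ n\<close>.\<close>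
  define A where "A = f t0 / (2 * t0) powr p"
  have A: "A > 0" using ft0 t0 by (simp add: A_def)
  \<comment> \<open>The subtracted constant makes the right-hand side nonpositive below
    \<open>t0\<close>, where \<open>f t \<ge> 0\<close> then suffices.\<close>
  have "f t \<ge> A * t powr p - A * t0 powr p" if "t \<ge> 0" for t
  proof (cases "t \<ge> t0")
    case True
    \<comment> \<open>The number of whole doublings of \<open>t0\<close> that do not pass
      \<open>t\<close>.\<close>
    define n where "n = nat \<lfloor>log 2 (t / t0)\<rfloor>"
    have "log 2 (t / t0) \<ge> 0" using True t0 by (simp add: zero_le_log_cancel_iff)
    then have n: "real n \<le> log 2 (t / t0)" "log 2 (t / t0) < real n + 1"
      by (simp_all add: n_def)
    have n1: "t0 * 2 ^ n \<le> t"
      using n(1) True t0 by (simp add: le_log_iff powr_realpow field_simps)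
    have "t / t0 < 2 powr (real n + 1)"
      using n(2) True t0 by (simp add: log_less_iff)
    then have n2: "t / (2 * t0) \<le> 2 ^ n"
      using t0 by (simp add: powr_add powr_realpow field_simps)
    have "A * t powr p = f t0 * (t / (2 * t0)) powr p"
      using t0 True by (simp add: A_def powr_divide)
    also have "\<dots> \<le> f t0 * (2 ^ n) powr p"
      using n2 ft0 p True t0 by (intro mult_left_mono powr_mono2) auto
    also have "(2 ^ n) powr p = k ^ n"
      by (simp add: k_p powr_powr mult.commute flip: powr_realpow)
    also have "f t0 * k ^ n \<le> f (t0 * 2 ^ n)" by (rule iter)
    also have "\<dots> \<le> f t" using n1 t0 by (intro mono) auto
    finally show ?thesis using A by (smt (verit) mult_nonneg_nonneg powr_ge_zero)
  next
    case False
    then have "A * t powr p \<le> A * t0 powr p"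
      using that A p by (intro mult_left_mono powr_mono2) auto
    then show ?thesis using nonneg[OF that] by linarith
  qed
  then show ?thesis using that[OF p A] by blast
qed

text \<open>A form of Young's inequality: up to the crossing point \<open>M\<close> the constant
  \<open>C * M\<close> dominates, and beyond it the power term alone does.\<close>

lemma linear_le_powr:
  fixes A C p :: real
  assumes "p > 1" "A > 0" "C \<ge> 0"
  obtains L where "L \<ge> 0" "\<And>y. y \<ge> 0 \<Longrightarrow> C * y \<le> A * y powr p + L"
proof -
  \<comment> \<open>the point where both sides agree\<close>
  define M where "M = (C / A) powr (1 / (p - 1))"
  have "C * y \<le> A * y powr p + C * M" if y: "y \<ge> 0" for y
  proof (cases "y \<le> M")
    case True
    then show ?thesis using assms by (smt (verit) mult_left_mono mult_nonneg_nonneg powr_ge_zero)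
  next
    case False
    have y0: "y > 0" using False by (smt (verit) M_def powr_ge_zero)
    have "C / A = M powr (p - 1)" using assms by (simp add: M_def powr_powr)
    also have "\<dots> \<le> y powr (p - 1)"
      using False assms by (intro powr_mono2) (auto simp: M_def)
    finally have "C \<le> A * y powr (p - 1)" using assms by (simp add: field_simps)
    then have "C * y \<le> A * y powr (p - 1) * y" using y by (rule mult_right_mono)
    also have "\<dots> = A * y powr p" using y0 powr_add[of y "p - 1" 1] by simp
    finally show ?thesis using assms by (smt (verit) M_def mult_nonneg_nonneg powr_ge_zero)
  qed
  moreover have "C * M \<ge> 0" using assms by (simp add: M_def)
  ultimately show ?thesis using that by blast
qed

section \<open>Localisation, measurability and integrability\<close>

text \<open>Otherwise \<open>b\<close> vanishes almost everywhere on each such ball. By Lindelof,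
  countably many of these balls cover \<open>\<Omega>\<close>, and a countable union of null sets is
  null.\<close>

lemma exists_ball_not_AE_zero:
  fixes b :: "'a::euclidean_space \<Rightarrow> real"
  assumes "open \<Omega>" "\<not> (AE x\<in>\<Omega> in lebesgue. b x = 0)"
  obtains c r where "r > 0" "cball c r \<subseteq> \<Omega>" "\<not> (AE x\<in>ball c r in lebesgue. b x = 0)"
proof (rule ccontr)
  assume "\<not> thesis"
  with that have null: "AE x\<in>ball c r in lebesgue. b x = 0" if "r > 0" "cball c r \<subseteq> \<Omega>" for c r
    using \<open>r > 0\<close> \<open>cball c r \<subseteq> \<Omega>\<close> by blast
  define \<F> where "\<F> = {ball c r |c r. r > 0 \<and> cball c r \<subseteq> \<Omega>}"
  have "\<And>S. S \<in> \<F> \<Longrightarrow> open S" by (auto simp: \<F>_def)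
  then obtain \<F>' where F': "\<F>' \<subseteq> \<F>" "countable \<F>'" "\<Union>\<F>' = \<Union>\<F>" by (rule Lindelof)
  have cover: "\<Omega> \<subseteq> \<Union>\<F>'"
  proof
    fix x assume "x \<in> \<Omega>"
    then obtain r where "r > 0" "cball x r \<subseteq> \<Omega>" using assms(1) open_contains_cball by blast
    then have "ball x r \<in> \<F>" "x \<in> ball x r" by (auto simp: \<F>_def)
    then show "x \<in> \<Union>\<F>'" using F'(3) by blast
  qed
  have "AE x in lebesgue. \<forall>S\<in>\<F>'. x \<in> S \<longrightarrow> b x = 0"
    using F' null by (subst AE_ball_countable) (auto simp: \<F>_def)
  then have "AE x\<in>\<Omega> in lebesgue. b x = 0" using cover by (auto elim!: eventually_mono)
  with assms(2) show False by simp
qed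

lemma set_integrable_mult_continuous:
  fixes w \<phi> :: "'a::euclidean_space \<Rightarrow> real"
  assumes w: "set_integrable lebesgue S w" and \<phi>: "continuous_on UNIV \<phi>"
    and B: "\<And>x. \<bar>\<phi> x\<bar> \<le> B"
  shows "set_integrable lebesgue S (\<lambda>x. w x * \<phi> x)"
proof (rule set_integrable_bound)
  show "set_integrable lebesgue S (\<lambda>x. B * w x)" using w by (rule set_integrable_mult_right)
  have "\<phi> \<in> borel_measurable lebesgue"
    using borel_measurable_continuous_onI[OF \<phi>] by (simp add: measurable_completion)
  moreover have "(\<lambda>x. indicator S x *\<^sub>R w x) \<in> borel_measurable lebesgue"
    using w by (auto simp: set_integrable_def)
  ultimately have "(\<lambda>x. (indicator S x *\<^sub>R w x) * \<phi> x) \<in> borel_measurable lebesgue"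
    by (rule borel_measurable_times[rotated])
  then show "set_borel_measurable lebesgue S (\<lambda>x. w x * \<phi> x)"
    by (simp add: set_borel_measurable_def mult.assoc)
  have "\<bar>w x * \<phi> x\<bar> \<le> \<bar>B * w x\<bar>" for x
    using mult_left_mono[OF B[of x], of "\<bar>w x\<bar>"] B[of x] by (simp add: abs_mult mult.commute)
  then show "AE x in lebesgue. x \<in> S \<longrightarrow> norm (w x * \<phi> x) \<le> norm (B * w x)" by simp
qed

text \<open>Since \<open>f\<close> is controlled only on \<open>{0..}\<close>, it is replaced by
  \<open>f (max 0 y)\<close>, which is continuous on the whole line and changes the composition only
  on a null set. Outside \<open>S\<close> the cut-off argument is 0, so \<open>f 0 = 0\<close> is
  what matches the two sides there.\<close>

lemma set_borel_measurable_compose_nonneg: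
  fixes f :: "real \<Rightarrow> real" and u :: "'a::euclidean_space \<Rightarrow> real"
  assumes f: "continuous_on {0..} f" "f 0 = 0"
    and u: "set_borel_measurable lebesgue S u" "AE x\<in>S in lebesgue. u x \<ge> 0"
  shows "set_borel_measurable lebesgue S (\<lambda>x. f (u x))"
proof -
  have "continuous_on UNIV (\<lambda>y. f (max 0 y))"
    by (rule continuous_on_compose2[OF f(1)]) (auto intro!: continuous_intros)
  then have "(\<lambda>y. f (max 0 y)) \<in> borel_measurable borel"
    by (rule borel_measurable_continuous_onI)
  with u(1) have "(\<lambda>x. f (max 0 (indicator S x *\<^sub>R u x))) \<in> borel_measurable lebesgue"
    unfolding set_borel_measurable_def by (rule measurable_compose)
  then show ?thesis
    unfolding set_borel_measurable_def
  proof (rule borel_measurable_AE)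
    show "AE x in lebesgue. f (max 0 (indicator S x *\<^sub>R u x)) = indicator S x *\<^sub>R f (u x)"
      using u(2) by eventually_elim (use f(2) in \<open>auto simp: indicator_def max_def\<close>)
  qed
qed

text \<open>From \<open>\<bar>y\<bar> \<le> 1 + y\<^sup>2\<close> and the finite measure of
  \<open>\<Omega>\<close>.\<close>

lemma L2_imp_L1:
  assumes "u \<in> L2 \<Omega>" "\<Omega> \<in> lmeasurable"
  shows "set_integrable lebesgue \<Omega> u"
proof (rule set_integrable_bound)
  have "set_integrable lebesgue \<Omega> (\<lambda>x. 1::real)"
    using assms(2) by (auto simp: set_integrable_def fmeasurable_def)
  then show "set_integrable lebesgue \<Omega> (\<lambda>x. 1 + (u x)\<^sup>2)"
    using assms(1) by (auto simp: L2_def)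
  show "set_borel_measurable lebesgue \<Omega> u" using assms(1) by (simp add: L2_def)
  have "\<bar>y\<bar> \<le> 1 + y\<^sup>2" for y :: real
    using zero_le_power2[of "\<bar>y\<bar> - 1"] by (simp add: power2_diff)
  then show "AE x in lebesgue. x \<in> \<Omega> \<longrightarrow> norm (u x) \<le> norm (1 + (u x)\<^sup>2)" by simp
qed

section \<open>Testing the equation\<close>

text \<open>The terms \<open>f (u x) * \<phi> x\<close> on the two sides of the equation cancel once
  they are known to be integrable. What remains is the integral of
  \<open>u x * ?D x - ?w x * \<phi> x\<close>, and dropping the nonnegative part
  \<open>\<mu> * a x * u x * \<phi> x\<close> bounds its integrand by \<open>H\<close>.\<close>

lemma very_weak_solution_test_bound:
  fixes \<Omega> :: "'a::euclidean_space set"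
  assumes sol: "very_weak_solution \<Omega> \<mu> a b f lam u"
    and \<Omega>: "\<Omega> \<in> lmeasurable"
    and a: "AE x\<in>\<Omega> in lebesgue. a x \<ge> 0" and b: "set_integrable lebesgue \<Omega> b"
    and \<mu>: "\<mu> > 0"
    and f: "continuous_on {0..} f" "f 0 = 0" "\<And>t. t \<ge> 0 \<Longrightarrow> f t \<ge> 0"
    and \<phi>: "\<phi> \<in> test_functions \<Omega>" "continuous_on UNIV \<phi>" "\<And>x. \<phi> x \<ge> 0" "\<And>x. \<phi> x \<le> B"
    and D: "continuous_on UNIV (laplacian (laplacian \<phi>))"
      "\<And>x. \<bar>laplacian (laplacian \<phi>) x\<bar> \<le> B'"
    and H: "\<And>x y. y \<ge> 0 \<Longrightarrow> y * laplacian (laplacian \<phi>) x - f y * \<phi> x \<le> H"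
  shows "lam * (LINT x:\<Omega>|lebesgue. b x * \<phi> x) \<le> H * measure lebesgue \<Omega>"
proof -
  let ?D = "laplacian (laplacian \<phi>)"
  let ?w = "\<lambda>x. \<mu> * a x * u x + f (u x)"
  define K where "K = closure {x. \<phi> x \<noteq> 0}"
  have K: "compact K" "K \<subseteq> \<Omega>" using \<phi>(1) by (auto simp: K_def test_functions_def)
  have off_K: "\<phi> x = 0" if "x \<notin> K" for x
    using that closure_subset[of "{x. \<phi> x \<noteq> 0}"] by (auto simp: K_def)
  have u: "set_integrable lebesgue \<Omega> u" "AE x\<in>\<Omega> in lebesgue. u x > 0"
    and w: "set_integrable lebesgue K ?w"
    and eq: "(LINT x:\<Omega>|lebesgue. u x * (?D x - \<mu> * a x * \<phi> x))
      = (LINT x:\<Omega>|lebesgue. (f (u x) + lam * b x) * \<phi> x)"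
    using sol K \<phi>(1) by (auto simp: very_weak_solution_def L1_def L1_loc_def)
  have \<phi>_abs: "\<bar>\<phi> x\<bar> \<le> B" for x using \<phi>(3,4) by simp
  have uD: "set_integrable lebesgue \<Omega> (\<lambda>x. u x * ?D x)"
    by (rule set_integrable_mult_continuous[OF u(1) D])
  have b\<phi>: "set_integrable lebesgue \<Omega> (\<lambda>x. b x * \<phi> x)"
    by (rule set_integrable_mult_continuous[OF b \<phi>(2) \<phi>_abs])
  have "set_integrable lebesgue K (\<lambda>x. ?w x * \<phi> x)"
    by (rule set_integrable_mult_continuous[OF w \<phi>(2) \<phi>_abs])
  \<comment> \<open>Local integrability of \<open>?w\<close> reaches only compact sets; as
    \<open>\<phi>\<close> vanishes off \<open>K\<close>, the product is integrable on all of
    \<open>\<Omega>\<close>.\<close>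
  also have "(\<lambda>x. indicator K x *\<^sub>R (?w x * \<phi> x)) = (\<lambda>x. indicator \<Omega> x *\<^sub>R (?w x * \<phi> x))"
    using K(2) off_K by (fastforce simp: indicator_def)
  then have "set_integrable lebesgue K (\<lambda>x. ?w x * \<phi> x) \<longleftrightarrow>
      set_integrable lebesgue \<Omega> (\<lambda>x. ?w x * \<phi> x)"
    by (simp only: set_integrable_def)
  finally have w\<phi>: "set_integrable lebesgue \<Omega> (\<lambda>x. ?w x * \<phi> x)" .
  \<comment> \<open>The definition of a solution gives integrability only of the sum
    \<open>?w\<close>. Both its summands are nonnegative almost everywhere, so the sum dominates
    \<open>f (u x)\<close>.\<close>
  have f\<phi>: "set_integrable lebesgue \<Omega> (\<lambda>x. f (u x) * \<phi> x)"
  proof (rule set_integrable_bound[OF w\<phi>])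
    have "AE x\<in>\<Omega> in lebesgue. u x \<ge> 0" using u(2) by eventually_elim auto
    moreover have "set_borel_measurable lebesgue \<Omega> u"
      using u(1) by (auto simp: set_integrable_def set_borel_measurable_def)
    ultimately have "set_borel_measurable lebesgue \<Omega> (\<lambda>x. f (u x))"
      by (intro set_borel_measurable_compose_nonneg[OF f(1,2)])
    moreover have "\<phi> \<in> borel_measurable lebesgue"
      using borel_measurable_continuous_onI[OF \<phi>(2)] by (simp add: measurable_completion)
    ultimately have "(\<lambda>x. (indicator \<Omega> x *\<^sub>R f (u x)) * \<phi> x) \<in> borel_measurable lebesgue"
      unfolding set_borel_measurable_def by (rule borel_measurable_times)
    then show "set_borel_measurable lebesgue \<Omega> (\<lambda>x. f (u x) * \<phi> x)"
      by (simp add: set_borel_measurable_def mult.assoc)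
    show "AE x\<in>\<Omega> in lebesgue. norm (f (u x) * \<phi> x) \<le> norm (?w x * \<phi> x)"
      using u(2) a
    proof eventually_elim
      case (elim x)
      show ?case
      proof
        assume "x \<in> \<Omega>"
        then have "u x > 0" "\<mu> * a x * u x \<ge> 0" "f (u x) \<ge> 0" using elim \<mu> f(3) by auto
        then show "norm (f (u x) * \<phi> x) \<le> norm (?w x * \<phi> x)"
          using \<phi>(3)[of x] by (simp add: abs_mult mult_right_mono)
      qed
    qed
  qed
  \<comment> \<open>The integrand is regrouped into three functions already known to be integrable,
    so that the integral may be split.\<close>
  have "(LINT x:\<Omega>|lebesgue. u x * (?D x - \<mu> * a x * \<phi> x))
      = (LINT x:\<Omega>|lebesgue. (u x * ?D x - ?w x * \<phi> x) + f (u x) * \<phi> x)"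
    by (simp add: algebra_simps)
  also have "\<dots> = (LINT x:\<Omega>|lebesgue. u x * ?D x - ?w x * \<phi> x) + (LINT x:\<Omega>|lebesgue. f (u x) * \<phi> x)"
    by (intro set_integral_add set_integral_diff uD w\<phi> f\<phi>)
  finally have lhs: "(LINT x:\<Omega>|lebesgue. u x * (?D x - \<mu> * a x * \<phi> x)) = \<dots>" .
  have "(LINT x:\<Omega>|lebesgue. (f (u x) + lam * b x) * \<phi> x)
      = (LINT x:\<Omega>|lebesgue. f (u x) * \<phi> x + lam * (b x * \<phi> x))"
    by (simp add: algebra_simps)
  also have "\<dots> = (LINT x:\<Omega>|lebesgue. f (u x) * \<phi> x) + lam * (LINT x:\<Omega>|lebesgue. b x * \<phi> x)"
    by (subst set_integral_add) (use f\<phi> b\<phi> in auto)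
  finally have "lam * (LINT x:\<Omega>|lebesgue. b x * \<phi> x) = (LINT x:\<Omega>|lebesgue. u x * ?D x - ?w x * \<phi> x)"
    using lhs eq by linarith
  also have "\<dots> \<le> (LINT x:\<Omega>|lebesgue. H)"
  proof (rule set_integral_mono_AE)
    show "set_integrable lebesgue \<Omega> (\<lambda>x. H)"
      using \<Omega> by (auto simp: set_integrable_def fmeasurable_def)
    show "AE x\<in>\<Omega> in lebesgue. u x * ?D x - ?w x * \<phi> x \<le> H"
      using u(2) a
    proof eventually_elim
      case (elim x)
      show ?case
      proof
        assume "x \<in> \<Omega>"
        then have "u x > 0" "\<mu> * a x * u x * \<phi> x \<ge> 0" using elim \<mu> \<phi>(3) by auto
        then show "u x * ?D x - ?w x * \<phi> x \<le> H"
          using H[of "u x" x] by (simp add: algebra_simps)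
      qed
    qed
  qed (intro set_integral_diff uD w\<phi>)
  also have "\<dots> = H * measure lebesgue \<Omega>"
    using \<Omega> by (simp add: set_lebesgue_integral_def fmeasurable_def)
  finally show ?thesis .
qed

text \<open>If the nonnegative integrand had integral 0, it would vanish almost everywhere; the bump
  is nonzero on the ball, so \<open>b\<close> would vanish almost everywhere there.\<close>

lemma set_integral_bump_pos:
  assumes b: "set_integrable lebesgue \<Omega> b" "AE x\<in>\<Omega> in lebesgue. b x \<ge> 0"
    and ball: "r > 0" "cball c r \<subseteq> \<Omega>" "\<not> (AE x\<in>ball c r in lebesgue. b x = 0)"
  shows "(LINT x:\<Omega>|lebesgue. b x * bump c r x) > 0"
proof -
  have int: "set_integrable lebesgue \<Omega> (\<lambda>x. b x * bump c r x)"
    by (rule set_integrable_mult_continuous[OF b(1) bump_span_continuous[OF bump_span_bump], of _ _ 1])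
      (simp add: bump_nonneg bump_le_1)
  have nonneg: "AE x in lebesgue. 0 \<le> indicator \<Omega> x *\<^sub>R (b x * bump c r x)"
    using b(2) by eventually_elim (auto simp: indicator_def bump_nonneg)
  have "(LINT x:\<Omega>|lebesgue. b x * bump c r x) \<noteq> 0"
  proof
    assume "(LINT x:\<Omega>|lebesgue. b x * bump c r x) = 0"
    then have "AE x in lebesgue. indicator \<Omega> x *\<^sub>R (b x * bump c r x) = 0"
      using integral_nonneg_eq_0_iff_AE[OF int[unfolded set_integrable_def] nonneg]
      by (simp add: set_lebesgue_integral_def)
    then have "AE x\<in>ball c r in lebesgue. b x = 0"
    proof eventually_elim
      case (elim x)
      show ?case
      proof
        assume x: "x \<in> ball c r"
        then have "x \<in> \<Omega>" using ball(2) by auto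
        then show "b x = 0" using elim x bump_eq_0_iff[OF ball(1), of c x] by simp
      qed
    qed
    with ball(3) show False by simp
  qed
  moreover have "(LINT x:\<Omega>|lebesgue. b x * bump c r x) \<ge> 0"
    unfolding set_lebesgue_integral_def by (rule integral_nonneg_AE[OF nonneg])
  ultimately show ?thesis by simp
qed

text \<open>The exponent \<open>q = 1 / p\<close> is the one for which the \<open>p\<close>-th power
  of \<open>y * bump c r x powr q\<close> is \<open>y powr p * bump c r x\<close>, the weight that
  accompanies \<open>f y\<close>. The constant \<open>K\<close> costs at most
  \<open>\<bar>K\<bar>\<close>, as the bump is at most 1.\<close>

lemma bump_span_absorbed:
  fixes h :: "'a::euclidean_space \<Rightarrow> real"
  assumes h: "bump_span c r h" and p: "p > 1" "A > 0"
    and f: "\<And>t. t \<ge> 0 \<Longrightarrow> f t \<ge> A * t powr p - K"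
  obtains H where "\<And>x y. y \<ge> 0 \<Longrightarrow> y * h x - f y * bump c r x \<le> H"
proof -
  obtain C where C: "C \<ge> 0" "\<And>x. \<bar>h x\<bar> \<le> C * bump c r x powr (1 / p)"
    using bump_span_bound[OF h, of "1 / p"] p by auto
  obtain L where L: "L \<ge> 0" "\<And>y. y \<ge> 0 \<Longrightarrow> C * y \<le> A * y powr p + L"
    using linear_le_powr[OF p C(1)] by blast
  have "y * h x - f y * bump c r x \<le> L + \<bar>K\<bar>" if y: "y \<ge> 0" for x y
  proof -
    let ?b = "bump c r x"
    have "y * h x \<le> y * (C * ?b powr (1 / p))"
      using C(2)[of x] y by (intro mult_left_mono) auto
    also have "\<dots> = C * (y * ?b powr (1 / p))" by simp
    also have "\<dots> \<le> A * (y * ?b powr (1 / p)) powr p + L"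
      using y by (intro L(2)) simp
    also have "(y * ?b powr (1 / p)) powr p = y powr p * ?b"
      using y p bump_nonneg[of c r x] by (simp add: powr_mult powr_powr)
    finally have "y * h x \<le> A * (y powr p * ?b) + L" .
    moreover have "(A * y powr p - K) * ?b \<le> f y * ?b"
      using f[OF y] bump_nonneg by (rule mult_right_mono)
    moreover have "K * ?b \<le> \<bar>K\<bar> * 1"
      by (intro mult_mono bump_le_1 bump_nonneg) auto
    ultimately show ?thesis by (simp add: algebra_simps)
  qed
  then show ?thesis using that by blast
qed

section \<open>Assembling the bound on the parameter\<close>

theorem lemma4p1:
  fixes \<Omega> :: "(real ^ 'n) set"
    and a b :: "real ^ 'n \<Rightarrow> real"
    and f f' :: "real \<Rightarrow> real"
    and \<gamma> \<mu> :: real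
  assumes "CARD('n) \<ge> 5"
    and "smooth_bounded_domain \<Omega>"
    and "a \<in> L1_loc \<Omega>" and "AE x\<in>\<Omega> in lebesgue. a x \<ge> 0"
    and "b \<in> L2 \<Omega>" and "AE x\<in>\<Omega> in lebesgue. b x \<ge> 0"
    and "\<not> (AE x\<in>\<Omega> in lebesgue. b x = 0)"
    and "\<gamma> > 0" and "stability_inequality \<Omega> a \<gamma>"
    and "0 < \<mu>" and "\<mu> < sqrt \<gamma>"
    and "\<And>t. t \<ge> 0 \<Longrightarrow> f t \<ge> 0"
    and "convex_on {0..} f"
    and "\<And>t. t \<ge> 0 \<Longrightarrow> (f has_real_derivative f' t) (at t within {0..})"
    and "continuous_on {0..} f'"
    and "f 0 = 0" and "f' 0 = 0"
    and "filterlim (\<lambda>t. f t / t) at_top at_top"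
    and "set_integrable lebesgue {1..} (ratio_sup f)"
    and "\<And>s. s > 1 \<Longrightarrow> s * ratio_sup f s < 1"
  shows "extremal_parameter \<Omega> \<mu> a b f < \<infinity>"
proof -
  note a_nonneg = assms(4) and b_L2 = assms(5) and b_nonneg = assms(6) and b_nonzero = assms(7)
    and \<mu>_pos = assms(10) and f_nonneg = assms(12) and f_convex = assms(13)
    and f_deriv = assms(14) and f_0 = assms(16) and f_lim = assms(18)
  have "open \<Omega>" "bounded \<Omega>" using assms(2) by (auto simp: smooth_bounded_domain_def)
  then have \<Omega>: "\<Omega> \<in> lmeasurable"
    by (simp add: bounded_set_imp_lmeasurable borel_open sets_completionI_sets)
  have b: "set_integrable lebesgue \<Omega> b" using b_L2 \<Omega> by (rule L2_imp_L1)
  have f_cont: "continuous_on {0..} f"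
    using f_deriv by (auto intro!: DERIV_continuous_on)
  obtain p A K where p: "p > 1" "A > 0" and f_growth: "\<And>t. t \<ge> 0 \<Longrightarrow> f t \<ge> A * t powr p - K"
    using superlinear_growth[OF f_nonneg f_convex f_0 f_lim assms(20)[of 2]] by auto
  obtain c r where ball: "r > 0" "cball c r \<subseteq> \<Omega>" "\<not> (AE x\<in>ball c r in lebesgue. b x = 0)"
    using exists_ball_not_AE_zero[OF \<open>open \<Omega>\<close> b_nonzero] by blast
  let ?\<phi> = "bump c r"
  let ?D = "laplacian (laplacian ?\<phi>)"
  have D: "bump_span c r ?D" by (intro bump_span_laplacian bump_span_bump)
  obtain B where B: "\<bar>?D x\<bar> \<le> B" for x
  proof -
    \<comment> \<open>The exponent \<open>q = 0\<close> turns the weighted estimate into plain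
      boundedness, because \<open>y powr 0\<close> is at most 1.\<close>
    obtain C where "C \<ge> 0" "\<And>x. \<bar>?D x\<bar> \<le> C * ?\<phi> x powr 0"
      using bump_span_bound[OF D, of 0] by auto
    moreover have "C * ?\<phi> x powr 0 \<le> C * 1" for x
      using \<open>C \<ge> 0\<close> by (intro mult_left_mono) auto
    ultimately have "\<bar>?D x\<bar> \<le> C" for x by (metis mult.right_neutral order_trans)
    then show ?thesis using that by blast
  qed
  obtain H where H: "\<And>x y. y \<ge> 0 \<Longrightarrow> y * ?D x - f y * ?\<phi> x \<le> H"
    using bump_span_absorbed[where f = f, OF D p f_growth] by blast
  define I where "I = (LINT x:\<Omega>|lebesgue. b x * ?\<phi> x)"
  have I: "I > 0" unfolding I_def by (rule set_integral_bump_pos[OF b b_nonneg ball])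
  \<comment> \<open>\<open>H\<close> and \<open>I\<close> were fixed before \<open>lam\<close> and
    \<open>u\<close>, so the bound is uniform over all solutions.\<close>
  have "lam \<le> H * measure lebesgue \<Omega> / I" if "very_weak_solution \<Omega> \<mu> a b f lam u" for lam u
  proof -
    have "lam * I \<le> H * measure lebesgue \<Omega>"
      unfolding I_def
      by (rule very_weak_solution_test_bound[OF that \<Omega> a_nonneg b \<mu>_pos f_cont f_0 f_nonneg
          bump_test_function[OF ball(1,2)] bump_span_continuous[OF bump_span_bump] bump_nonneg
          bump_le_1 bump_span_continuous[OF D] B H])
    then show ?thesis using I by (simp add: pos_le_divide_eq)
  qed
  \<comment> \<open>The supremum is taken in \<open>ereal\<close>, so the estimate also covers an
    empty set of parameters.\<close>
  then have "extremal_parameter \<Omega> \<mu> a b f \<le> ereal (H * measure lebesgue \<Omega> / I)"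
    by (auto simp: extremal_parameter_def intro!: Sup_least)
  then show ?thesis by (rule order.strict_trans1) simp
qed

end
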